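(* Let $\phi = \frac{1+\sqrt{5}}{2}$ and let $f(n) := L(n+1) - L(n)$ for positive integers $n$. Then: (1) $\displaystyle\lim_{N\to\infty} \frac{1}{N}\#\{1\le n\le N : f(n) < 0\} = \frac{\phi}{3\phi+2} = 0.2360\ldots$; (2) $\displaystyle\lim_{N\to\infty} \frac{1}{N}\#\{1\le n\le N : f(n) = 0\} = \frac{\phi}{1+2\phi} = 0.38196\ldots$; (3) $\displaystyle\lim_{N\to\infty} \frac{1}{N}\#\{1\le n\le N : f(n) > 0\} = \frac{\phi}{1+2\phi} = 0.38196\ldots$.
   Context: The Fibonacci sequence is defined by $F_0 = 0$, $F_1 = 1$, and $F_n = F_{n-1}+F_{n-2}$ for $n\ge 2$. By Zeckendorf's theorem, every positive integer $n$ can be written uniquely as $n = \sum_{i=1}^{k} F_{c_i}$ with $k \ge 1$, $c_1\ge 2$, and $c_i \ge c_{i-1}+2$ for $2\le i\le k$; this is the Zeckendorf partition of $n$. Let $L(n) := k$ be the number of summands in the Zeckendorf partition of $n$. The "probability" that a positive integer has a property means the limit as $N\to\infty$ of the proportion of positive integers $n \le N$ with that property. *)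

theory Defs
  imports Complex_Main "HOL-Number_Theory.Fib"
begin

text \<open>
  The list \<open>cs = [c\<^sub>1, \<dots>, c\<^sub>k]\<close> gives the indices of a Zeckendorf partition of \<open>n\<close>,
  in increasing order.
\<close>

definition zeckendorf :: "nat list \<Rightarrow> nat \<Rightarrow> bool" where
  "zeckendorf cs n \<longleftrightarrow>
     cs \<noteq> [] \<and> hd cs \<ge> 2 \<and> successively (\<lambda>c d. d \<ge> c + 2) cs \<and> n = (\<Sum>c\<leftarrow>cs. fib c)"

text \<open>
  Unspecified at \<open>n = 0\<close>, which has no such partition; for \<open>n > 0\<close> the description is proper
  by \<open>zeckendorf_ex1\<close> below.
\<close>

definition L :: "nat \<Rightarrow> nat" where
  "L n = length (THE cs. zeckendorf cs n)"

definition f :: "nat \<Rightarrow> int" where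
  "f n = int (L (n + 1)) - int (L n)"

definition has_natural_density :: "(nat \<Rightarrow> bool) \<Rightarrow> real \<Rightarrow> bool" where
  "has_natural_density P d \<longleftrightarrow>
     (\<lambda>N. real (card {n. 1 \<le> n \<and> n \<le> N \<and> P n}) / real N) \<longlonglongrightarrow> d"

definition phi :: real where
  "phi = (1 + sqrt 5) / 2"

lemma zeckendorf_snoc:
  "zeckendorf (cs @ [c]) n \<longleftrightarrow>
     (if cs = [] then c \<ge> 2 \<and> n = fib c
      else c \<ge> last cs + 2 \<and> fib c \<le> n \<and> zeckendorf cs (n - fib c))"
  by (auto simp: zeckendorf_def successively_append_iff)

lemma zeckendorf_bounds:
  "zeckendorf cs n \<Longrightarrow> 2 \<le> last cs \<and> fib (last cs) \<le> n \<and> n < fib (Suc (last cs))"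
proof (induction cs arbitrary: n rule: rev_induct)
  case Nil
  then show ?case by (simp add: zeckendorf_def)
next
  case (snoc c cs)
  obtain d where d: "c = Suc d" "1 \<le> d" if "c \<ge> 2"
    by (metis Suc_le_D Suc_le_mono numeral_2_eq_2 One_nat_def)
  show ?case
  proof (cases "cs = []")
    case True
    with snoc.prems have "c \<ge> 2" "n = fib c" using zeckendorf_snoc[of "[]" c n] by auto
    with d show ?thesis using fib_neq_0_nat[of d] by simp
  next
    case False
    with snoc.prems have *: "c \<ge> last cs + 2" "fib c \<le> n" "zeckendorf cs (n - fib c)"
      by (auto simp: zeckendorf_snoc)
    from snoc.IH[OF *(3)] have "n - fib c < fib (Suc (last cs))" by simp
    also have "\<dots> \<le> fib d" using * d by (intro fib_mono) auto
    finally show ?thesis using * d by simp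
  qed
qed

lemma zeckendorf_unique:
  "zeckendorf cs n \<Longrightarrow> zeckendorf ds n \<Longrightarrow> cs = ds"
proof (induction cs arbitrary: n ds rule: rev_induct)
  case Nil
  then show ?case by (simp add: zeckendorf_def)
next
  case (snoc c cs)
  from snoc.prems(2) obtain es e where ds: "ds = es @ [e]"
    by (metis rev_exhaust zeckendorf_def)
  have "fib c \<le> n" "n < fib (Suc c)" "fib e \<le> n" "n < fib (Suc e)"
    using zeckendorf_bounds[OF snoc.prems(1)] zeckendorf_bounds[OF snoc.prems(2)] ds by auto
  then have [simp]: "e = c"
    by (metis fib_mono leD le_less_trans not_less_eq_eq le_antisym)
  have pos: "n > 0" if "zeckendorf bs n" for bs n
    using zeckendorf_bounds[OF that] fib_neq_0_nat[of "last bs"] by linarith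
  have "\<not> zeckendorf bs (fib c - fib c)" for bs
    using pos by fastforce
  then have "cs = [] \<longleftrightarrow> es = []"
    using snoc.prems unfolding ds zeckendorf_snoc by (auto split: if_splits)
  moreover have "cs = es" if "cs \<noteq> []" "es \<noteq> []"
    using snoc.prems that unfolding ds zeckendorf_snoc by (auto intro: snoc.IH)
  ultimately show ?case using ds by auto
qed

lemma zeckendorf_exists: "n > 0 \<Longrightarrow> \<exists>cs. zeckendorf cs n"
proof (induction n rule: less_induct)
  case (less n)
  have ge: "k < fib (Suc (Suc k))" for k
  proof (induction k)
    case (Suc k)
    then show ?case using fib_neq_0_nat[of "Suc k"] by simp
  qed simp
  define c where "c = (GREATEST c. fib c \<le> n)"
  have bd: "\<forall>c. fib c \<le> n \<longrightarrow> c \<le> Suc (Suc n)"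
    by (metis fib_mono ge leD le_less_trans nat_le_linear)
  have c: "fib c \<le> n" unfolding c_def
    by (rule GreatestI_nat[where k = 0, OF _ bd[rule_format]]) auto
  have cg: "k \<le> c" if "fib k \<le> n" for k
    unfolding c_def using that bd by (metis (mono_tags, lifting) Greatest_le_nat)
  have "2 \<le> c" using less.prems by (intro cg) (simp add: numeral_2_eq_2)
  then obtain d where d: "c = Suc d" "1 \<le> d"
    by (metis Suc_le_D Suc_le_mono numeral_2_eq_2 One_nat_def)
  have lt: "n < fib (Suc c)" using cg[of "Suc c"] by (meson Suc_n_not_le_n not_le)
  show ?case
  proof (cases "n = fib c")
    case True
    with \<open>2 \<le> c\<close> have "zeckendorf ([] @ [c]) n" by (subst zeckendorf_snoc) simp
    then show ?thesis by blast
  next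
    case False
    with c have "0 < n - fib c" "n - fib c < n"
      using fib_neq_0_nat[of c] \<open>2 \<le> c\<close> by auto
    from less.IH[OF this(2,1)] obtain cs where cs: "zeckendorf cs (n - fib c)" by blast
    have "fib (last cs) < fib d" using zeckendorf_bounds[OF cs] lt c d \<open>2 \<le> c\<close> by (auto simp del: One_nat_def; linarith)
    then have "last cs < d" by (meson fib_mono leD not_le)
    moreover have "cs \<noteq> []" using cs by (simp add: zeckendorf_def)
    ultimately have "zeckendorf (cs @ [c]) n" using cs c d by (simp add: zeckendorf_snoc)
    then show ?thesis by blast
  qed
qed

theorem zeckendorf_ex1: "n > 0 \<Longrightarrow> \<exists>!cs. zeckendorf cs n"
  using zeckendorf_exists zeckendorf_unique by blast

lemma L_eq: "zeckendorf cs n \<Longrightarrow> L n = length cs"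
  unfolding L_def using zeckendorf_unique by (metis (mono_tags, lifting) the_equality)

end

theory Submission
  imports Defs
begin

text \<open>
  The increment \<open>f\<close> is self-similar. If \<open>0 < m < fib c\<close>, the Zeckendorf partition of
  \<open>fib (c + 1) + m\<close> is that of \<open>m\<close> with one further summand, so adding \<open>fib (c + 1)\<close> raises
  \<open>L m\<close> and \<open>L (m + 1)\<close> equally and leaves \<open>f m\<close> unchanged, except possibly at the last
  position \<open>m = fib c - 1\<close>. There \<open>m + 1\<close> is itself a Fibonacci number, with a single summand,
  while \<open>m\<close> has at least two, so \<open>f\<close> is negative before and after the translation. If \<open>0\<close> is
  counted as a number with positive increment, then, from \<open>c = 5\<close> on, the sign pattern of \<open>f\<close>
  on an interval \<open>[fib (c + 1), fib (c + 2))\<close> is an exact copy of the pattern on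
  \<open>[0, fib c)\<close>; see \<open>f_translate\<close> for the increment itself and
  \<open>f_before_fib_neg\<close> for the last position.

  Hence for each sign the number \<open>A N\<close> of members below \<open>N\<close> satisfies
  \<open>A (fib (c + 1) + m) = A (fib (c + 1)) + A m\<close> for \<open>m \<le> fib c\<close>. In particular
  \<open>A (fib c)\<close> obeys the Fibonacci recursion, and the numbers up to \<open>7\<close> provide the initial
  values, whence \<open>A (fib c) = fib (c - 2)\<close> for the signs \<open>+\<close> and \<open>0\<close>, and
  \<open>A (fib c) = fib (c - 3)\<close> for the sign \<open>-\<close>.
  Cutting an arbitrary \<open>N\<close> into Fibonacci numbers gives \<open>A N = N / phi ^ j + O(1)\<close> with
  \<open>j = 2\<close> or \<open>j = 3\<close>, because the errors at the individual Fibonacci numbers form a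
  geometric series. Finally \<open>phi / (1 + 2 * phi) = 1 / phi ^ 2\<close> and
  \<open>phi / (3 * phi + 2) = 1 / phi ^ 3\<close>.
\<close>

section \<open>The golden ratio and Fibonacci numbers\<close>

lemma phi_gt_1: "phi > 1"
proof -
  have "sqrt 5 > sqrt 1" by (subst real_sqrt_less_iff) simp
  then show ?thesis by (simp add: phi_def)
qed

lemma phi_square: "phi ^ 2 = phi + 1"
  by (simp add: phi_def power2_eq_square field_simps)

lemma fib_Suc_phi: "real (fib (Suc n)) = phi * fib n + (1 - phi) ^ n"
proof (induction n)
  case (Suc n)
  have "real (fib (Suc (Suc n))) = phi * fib n + (1 - phi) ^ n + fib n"
    using Suc.IH by simp
  also have "\<dots> = phi ^ 2 * fib n + (1 - phi) ^ n"
    by (simp add: phi_square algebra_simps)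
  also have "\<dots> = phi * fib (Suc n) + (1 - phi) ^ Suc n"
    unfolding Suc.IH by (simp add: power2_eq_square algebra_simps)
  finally show ?case .
qed simp

lemma fib_add_phi: "real (fib (n + j)) = phi ^ j * fib n + (1 - phi) ^ n * fib j"
proof (induction j)
  case (Suc j)
  have "real (fib (n + Suc j)) = phi * fib (n + j) + (1 - phi) ^ (n + j)"
    using fib_Suc_phi[of "n + j"] by simp
  also have "\<dots> = phi ^ Suc j * fib n + (1 - phi) ^ n * (phi * fib j + (1 - phi) ^ j)"
    unfolding Suc.IH by (simp add: power_add algebra_simps)
  finally show ?case by (simp only: fib_Suc_phi[symmetric])
qed simp

lemma fib_quotient_error:
  "\<bar>real (fib n) - fib (n + j) / phi ^ j\<bar> = fib j * (1 / phi) ^ (n + j)"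
proof -
  have "\<bar>1 - phi\<bar> = 1 / phi"
    using phi_gt_1 phi_square by (simp add: field_simps power2_eq_square)
  then have pow: "\<bar>(1 - phi) ^ n\<bar> = (1 / phi) ^ n" by (simp add: power_abs)
  have "real (fib n) - fib (n + j) / phi ^ j = - ((1 - phi) ^ n * fib j * (1 / phi) ^ j)"
    unfolding fib_add_phi using phi_gt_1 by (simp add: field_simps power_divide)
  then show ?thesis using phi_gt_1 by (simp add: abs_mult pow power_add)
qed

section \<open>Densities of Fibonacci-self-similar sets\<close>

definition count_below :: "(nat \<Rightarrow> bool) \<Rightarrow> nat \<Rightarrow> nat" where
  "count_below P N = card {n. n < N \<and> P n}"

lemma count_below_0 [simp]: "count_below P 0 = 0"
  by (simp add: count_below_def)

lemma count_below_Suc: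
  "count_below P (Suc N) = count_below P N + (if P N then 1 else 0)"
proof -
  have "{n. n < Suc N \<and> P n} = (if P N then insert N {n. n < N \<and> P n} else {n. n < N \<and> P n})"
    by (auto simp: less_Suc_eq)
  then show ?thesis by (simp add: count_below_def)
qed

lemma count_below_numeral:
  "count_below P (numeral k) =
     count_below P (pred_numeral k) + (if P (pred_numeral k) then 1 else 0)"
  by (simp add: numeral_eq_Suc count_below_Suc)

lemma count_below_le: "count_below P N \<le> N"
  by (induction N) (auto simp: count_below_Suc)

lemma count_below_translate:
  "(\<And>i. i < m \<Longrightarrow> P (a + i) = P i) \<Longrightarrow> count_below P (a + m) = count_below P a + count_below P m"
  by (induction m) (auto simp: count_below_Suc)

text \<open>
  A number between \<open>fib (c + 1)\<close> and \<open>fib (c + 2)\<close> is cut into \<open>fib (c + 1)\<close> and a remainder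
  \<open>m \<le> fib c\<close>, and the discrepancies of the two parts add up. The bound
  \<open>C - fib j * r ^ c\<close>, where \<open>r = 1 / phi\<close>, is shaped so as to survive this step: by
  \<open>r + r\<^sup>2 = 1\<close>, the discrepancy \<open>fib j * r ^ (c + 1)\<close> of \<open>fib (c + 1)\<close> is exactly the amount by
  which the bound grows from \<open>c\<close> to \<open>c + 2\<close>.
\<close>

lemma self_similar_discrepancy_bounded:
  assumes self_similar: "\<And>c m. k \<le> c \<Longrightarrow> m < fib c \<Longrightarrow> P (fib (Suc c) + m) = P m"
    and initial: "k = i + j" "count_below P (fib k) = fib i"
      "count_below P (fib (Suc k)) = fib (Suc i)"
  shows "\<exists>C. \<forall>N. \<bar>real (count_below P N) - N / phi ^ j\<bar> \<le> C"
proof -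
  define r where "r = 1 / phi"
  define E where "E N = real (count_below P N) - N / phi ^ j" for N :: nat
  define C where "C = real (fib (Suc k)) + fib j"
  have r: "0 < r" "r \<le> 1" using phi_gt_1 by (auto simp: r_def)
  have r_square: "r + r ^ 2 = 1"
    using phi_gt_1 phi_square by (simp add: r_def field_simps power2_eq_square)
  have add: "count_below P (fib (Suc c) + m) = count_below P (fib (Suc c)) + count_below P m"
    if "k \<le> c" "m \<le> fib c" for c m
    using that by (intro count_below_translate self_similar) auto
  have count_fib: "count_below P (fib (k + t)) = fib (i + t)" for t
  proof (induction t rule: fib.induct)
    case (3 t)
    then show ?case using add[of "k + t" "fib (k + t)"] by simp
  qed (use initial in simp_all)
  have E_fib: "\<bar>E (fib (k + t))\<bar> = fib j * r ^ (k + t)" for t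
    using fib_quotient_error[of "i + t" j] unfolding E_def count_fib
    by (simp add: initial(1) r_def ac_simps)
  have E_small: "\<bar>E N\<bar> \<le> C - fib j * r ^ c" if "N \<le> fib (Suc k)" for N c
  proof -
    have "N / phi ^ j \<le> N" using phi_gt_1 by (simp add: divide_le_eq mult_le_cancel_left1)
    moreover have "0 \<le> N / phi ^ j" using phi_gt_1 by simp
    ultimately have "\<bar>E N\<bar> \<le> fib (Suc k)"
      using count_below_le[of P N] that unfolding E_def by linarith
    moreover have "fib j * r ^ c \<le> real (fib j)"
      using r by (simp add: mult_left_le power_le_one)
    ultimately show ?thesis by (simp add: C_def)
  qed
  have E_bound: "\<bar>E N\<bar> \<le> C - fib j * r ^ (k + t)" if "N \<le> fib (k + t)" for N t
    using that
  proof (induction t arbitrary: N rule: fib.induct)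
    case 1
    then show ?case using E_small fib_mono[of k "Suc k"] by (simp add: order_trans)
  next
    case 2
    then show ?case using E_small[of N "k + Suc 0"] by simp
  next
    case (3 t)
    show ?case
    proof (cases "N \<le> fib (k + Suc t)")
      case True
      moreover have "fib j * r ^ (k + Suc (Suc t)) \<le> fib j * r ^ (k + Suc t)"
        using r by (intro mult_left_mono power_decreasing) auto
      ultimately show ?thesis using "3.IH"(1)[of N] by linarith
    next
      case False
      define m where "m = N - fib (k + Suc t)"
      have m: "N = fib (Suc (k + t)) + m" "m \<le> fib (k + t)"
        using False "3.prems" by (auto simp: m_def)
      have "E N = E (fib (k + Suc t)) + E m"
        unfolding E_def m(1) using add[OF _ m(2)] by (simp add: add_divide_distrib)
      then have "\<bar>E N\<bar> \<le> fib j * r ^ (k + Suc t) + (C - fib j * r ^ (k + t))"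
        using E_fib[of "Suc t"] "3.IH"(2)[OF m(2)] by linarith
      also have "\<dots> = C - fib j * r ^ (k + t) * (1 - r)"
        by (simp add: algebra_simps)
      also have "1 - r = r ^ 2" using r_square by simp
      finally show ?thesis by (simp add: power2_eq_square algebra_simps)
    qed
  qed
  have "\<bar>E N\<bar> \<le> C" for N
  proof -
    have "n < fib (Suc (Suc n))" for n
    proof (induction n)
      case (Suc n)
      then show ?case using fib_neq_0_nat[of "Suc n"] by simp
    qed simp
    then have "N \<le> fib (Suc (Suc N))" by (simp add: less_imp_le)
    also have "\<dots> \<le> fib (k + Suc (Suc N))" by (rule fib_mono) simp
    finally have "\<bar>E N\<bar> \<le> C - fib j * r ^ (k + Suc (Suc N))" by (rule E_bound)
    also have "\<dots> \<le> C" using r by simp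
    finally show ?thesis .
  qed
  then show ?thesis unfolding E_def by blast
qed

lemma has_natural_density_of_bounded_discrepancy:
  fixes d :: real
  assumes "\<And>N. \<bar>real (count_below P N) - d * N\<bar> \<le> C"
  shows "has_natural_density P d"
proof -
  define A where "A N = card {n. 1 \<le> n \<and> n \<le> N \<and> P n}" for N
  have A: "count_below P (Suc N) = A N + (if P 0 then 1 else 0)" for N
  proof -
    have "{n. n < Suc N \<and> P n} =
        (if P 0 then insert 0 {n. 1 \<le> n \<and> n \<le> N \<and> P n} else {n. 1 \<le> n \<and> n \<le> N \<and> P n})"
      by (auto simp: Suc_le_eq intro: gr0I)
    then show ?thesis by (simp add: count_below_def A_def)
  qed
  have "\<bar>real (A N) - d * N\<bar> \<le> C + 1 + \<bar>d\<bar>" for N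
    using assms[of "Suc N"] unfolding A by (simp add: algebra_simps split: if_splits)
  then have "\<bar>(real (A N) - d * N) / N\<bar> \<le> (C + 1 + \<bar>d\<bar>) / N" for N
    by (simp add: divide_right_mono)
  then have "(\<lambda>N. (real (A N) - d * N) / N) \<longlonglongrightarrow> 0"
    by (intro tendsto_0_le[OF lim_const_over_n[of "C + 1 + \<bar>d\<bar>"], where K = 1] always_eventually)
      (auto intro: order_trans[OF _ divide_right_mono[OF abs_ge_self]])
  then have "(\<lambda>N. (real (A N) - d * N) / N + d) \<longlonglongrightarrow> 0 + d"
    by (intro tendsto_add tendsto_const)
  moreover have "\<forall>\<^sub>F N in sequentially. (real (A N) - d * N) / N + d = A N / N"
    using eventually_gt_at_top[of 0] by eventually_elim (simp add: field_simps)
  ultimately have "(\<lambda>N. real (A N) / N) \<longlonglongrightarrow> d"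
    by (simp add: filterlim_cong)
  then show ?thesis unfolding has_natural_density_def A_def .
qed

text \<open>
  The two initial counts start the Fibonacci recursion for the counts below Fibonacci numbers, so
  that they are the Fibonacci numbers \<open>j\<close> places earlier; the ratio tends to \<open>1 / phi ^ j\<close>.
\<close>

theorem self_similar_natural_density:
  assumes "\<And>c m. k \<le> c \<Longrightarrow> m < fib c \<Longrightarrow> P (fib (Suc c) + m) = P m"
    and "k = i + j" "count_below P (fib k) = fib i" "count_below P (fib (Suc k)) = fib (Suc i)"
  shows "has_natural_density P (1 / phi ^ j)"
proof -
  obtain C where "\<bar>real (count_below P N) - N / phi ^ j\<bar> \<le> C" for N
    using self_similar_discrepancy_bounded[where P = P, OF assms] by blast
  then show ?thesis by (simp add: has_natural_density_of_bounded_discrepancy[where C = C])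
qed

section \<open>Self-similarity of the sign of the increment\<close>

lemma L_fib: "2 \<le> c \<Longrightarrow> L (fib c) = 1"
  using L_eq[of "[c]" "fib c"] by (simp add: zeckendorf_def)

lemma L_fib_add:
  assumes "0 < m" "m < fib c"
  shows "L (fib (Suc c) + m) = Suc (L m)"
proof -
  obtain cs where cs: "zeckendorf cs m" using zeckendorf_exists assms(1) by blast
  have "fib (last cs) < fib c" using zeckendorf_bounds[OF cs] assms(2) by simp
  then have "last cs < c" by (meson fib_mono leD not_le)
  then have "zeckendorf (cs @ [Suc c]) (fib (Suc c) + m)"
    using cs unfolding zeckendorf_snoc by (simp add: zeckendorf_def)
  then show ?thesis using L_eq cs by fastforce
qed

lemma f_translate:
  assumes "0 < m" "Suc m < fib c"
  shows "f (fib (Suc c) + m) = f m"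
  using L_fib_add[of m c] L_fib_add[of "Suc m" c] assms by (simp add: f_def)

lemma f_fib_pos:
  assumes "4 \<le> c"
  shows "0 < f (fib c)"
proof -
  define d where "d = c - 1"
  have d: "c = Suc d" "3 \<le> d" using assms by (auto simp: d_def)
  have "fib 3 \<le> fib d" using d by (intro fib_mono)
  then have "1 < fib d" by (simp add: eval_nat_numeral)
  then have "L (fib c + 1) = 2"
    using L_fib_add[of 1 d] L_fib[of 2] d by (simp add: eval_nat_numeral)
  then show ?thesis using L_fib[of c] assms by (simp add: f_def)
qed

lemma f_before_fib_neg:
  assumes "5 \<le> c"
  shows "f (fib c - 1) < 0"
proof -
  define d where "d = c - 2"
  have d: "c = Suc (Suc d)" "3 \<le> d" using assms by (auto simp: d_def)
  have "fib 3 \<le> fib d" using d by (intro fib_mono)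
  then have fib_d: "1 < fib d" by (simp add: eval_nat_numeral)
  have "\<exists>cs. zeckendorf cs (fib d - 1)" using fib_d by (intro zeckendorf_exists) simp
  then have "1 \<le> L (fib d - 1)" using L_eq by (fastforce simp: zeckendorf_def Suc_le_eq)
  moreover have "fib c - 1 = fib (Suc d) + (fib d - 1)" using d fib_d by simp
  ultimately have "2 \<le> L (fib c - 1)" using L_fib_add[of "fib d - 1" d] fib_d by simp
  moreover have "L (fib c - 1 + 1) = 1"
    using L_fib[of c] assms fib_neq_0_nat[of c] by simp
  ultimately show ?thesis by (simp add: f_def)
qed

text \<open>
  Since \<open>f 0\<close> has no meaning, the value \<open>1\<close> at \<open>0\<close> is a convention. It is the one that fits
  the pattern: the translates of \<open>0\<close> are Fibonacci numbers, whose increment is positive from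
  \<open>fib 4 = 3\<close> on.
\<close>

definition f_sign :: "nat \<Rightarrow> int" where
  "f_sign n = (if n = 0 then 1 else sgn (f n))"

lemma f_sign_self_similar:
  assumes "5 \<le> c" "m < fib c"
  shows "f_sign (fib (Suc c) + m) = f_sign m"
proof -
  have pos: "0 < fib (Suc c)" by (simp add: fib_neq_0_nat)
  consider "m = 0" | "0 < m" "Suc m < fib c" | "0 < m" "Suc m = fib c"
    using assms(2) by linarith
  then show ?thesis
  proof cases
    case 1
    then show ?thesis using f_fib_pos[of "Suc c"] assms(1) pos by (simp add: f_sign_def)
  next
    case 2
    then show ?thesis using f_translate pos by (simp add: f_sign_def)
  next
    case 3
    then have "fib (Suc c) + m = fib (Suc (Suc c)) - 1" "m = fib c - 1" by simp_all
    then have "f (fib (Suc c) + m) < 0" "f m < 0"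
      using f_before_fib_neg[of "Suc (Suc c)"] f_before_fib_neg[of c] assms(1) by simp_all
    then show ?thesis using 3 by (simp add: f_sign_def)
  qed
qed

lemma f_sign_below_8:
  "f_sign 0 = 1" "f_sign (Suc 0) = 0" "f_sign 2 = 0" "f_sign 3 = 1"
  "f_sign 4 = -1" "f_sign 5 = 1" "f_sign 6 = 0" "f_sign 7 = -1"
proof -
  have L: "L 1 = 1" "L 2 = 1" "L 3 = 1" "L 5 = 1" "L 8 = 1"
    using L_fib[of 2] L_fib[of 3] L_fib[of 4] L_fib[of 5] L_fib[of 6]
    by (simp_all add: eval_nat_numeral)
  have "L 4 = 2" "L 6 = 2" "L 7 = 2"
    using L_fib_add[of 1 3] L_fib_add[of 1 4] L_fib_add[of 2 4] L
    by (simp_all add: eval_nat_numeral)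
  with L show "f_sign 0 = 1" "f_sign (Suc 0) = 0" "f_sign 2 = 0" "f_sign 3 = 1"
    "f_sign 4 = -1" "f_sign 5 = 1" "f_sign 6 = 0" "f_sign 7 = -1"
    by (simp_all add: f_sign_def f_def numeral_2_eq_2[symmetric])
qed

lemma f_sign_density:
  assumes "5 = i + j" "count_below (\<lambda>n. f_sign n = s) 5 = fib i"
    "count_below (\<lambda>n. f_sign n = s) 8 = fib (Suc i)"
  shows "has_natural_density (\<lambda>n. f_sign n = s) (1 / phi ^ j)"
proof (rule self_similar_natural_density)
  have "fib 5 = 5" "fib (Suc 5) = 8" by (simp_all add: eval_nat_numeral)
  then show "count_below (\<lambda>n. f_sign n = s) (fib 5) = fib i"
    "count_below (\<lambda>n. f_sign n = s) (fib (Suc 5)) = fib (Suc i)"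
    using assms by simp_all
qed (use assms(1) f_sign_self_similar in auto)

lemma has_natural_density_cong:
  assumes "\<And>n. 1 \<le> n \<Longrightarrow> P n = Q n"
  shows "has_natural_density P d = has_natural_density Q d"
proof -
  have "{n. 1 \<le> n \<and> n \<le> N \<and> P n} = {n. 1 \<le> n \<and> n \<le> N \<and> Q n}" for N
    using assms by blast
  then show ?thesis by (simp add: has_natural_density_def)
qed

theorem corollary1p3:
  shows "has_natural_density (\<lambda>n. f n < 0) (phi / (3 * phi + 2)) \<and>
         0.2360 \<le> phi / (3 * phi + 2) \<and> phi / (3 * phi + 2) < 0.2361 \<and>
         has_natural_density (\<lambda>n. f n = 0) (phi / (1 + 2 * phi)) \<and>
         has_natural_density (\<lambda>n. f n > 0) (phi / (1 + 2 * phi)) \<and>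
         0.38196 \<le> phi / (1 + 2 * phi) \<and> phi / (1 + 2 * phi) < 0.38197"
proof -
  have fib: "fib 2 = 1" "fib 3 = 2" "fib 4 = 3" by (simp_all add: eval_nat_numeral)
  note count = count_below_numeral count_below_Suc f_sign_below_8 fib
  have "has_natural_density (\<lambda>n. f_sign n = -1) (1 / phi ^ 3)"
    by (rule f_sign_density[of 2]) (simp_all add: count)
  moreover have "has_natural_density (\<lambda>n. f_sign n = 0) (1 / phi ^ 2)"
    by (rule f_sign_density[of 3]) (simp_all add: count)
  moreover have "has_natural_density (\<lambda>n. f_sign n = 1) (1 / phi ^ 2)"
    by (rule f_sign_density[of 3]) (simp_all add: count)
  moreover have "has_natural_density (\<lambda>n. f_sign n = -1) d = has_natural_density (\<lambda>n. f n < 0) d"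
    "has_natural_density (\<lambda>n. f_sign n = 0) d = has_natural_density (\<lambda>n. f n = 0) d"
    "has_natural_density (\<lambda>n. f_sign n = 1) d = has_natural_density (\<lambda>n. f n > 0) d" for d
    by (rule has_natural_density_cong, simp add: f_sign_def sgn_if)+
  moreover have "1 / phi ^ 2 = phi / (1 + 2 * phi)" "1 / phi ^ 3 = phi / (3 * phi + 2)"
    using phi_gt_1 phi_square by (simp_all add: divide_simps, algebra+)
  moreover have "0.2360 \<le> phi / (3 * phi + 2)" "phi / (3 * phi + 2) < 0.2361"
    "0.38196 \<le> phi / (1 + 2 * phi)" "phi / (1 + 2 * phi) < 0.38197"
  proof -
    have "2.23606 < sqrt 5" "sqrt 5 < 2.23608"
      by (rule real_less_rsqrt real_less_lsqrt; simp add: power2_eq_square)+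
    then have "1.61803 < phi" "phi < 1.61804" by (simp_all add: phi_def)
    then show "0.2360 \<le> phi / (3 * phi + 2)" "phi / (3 * phi + 2) < 0.2361"
      "0.38196 \<le> phi / (1 + 2 * phi)" "phi / (1 + 2 * phi) < 0.38197"
      by (simp_all add: field_simps)
  qed
  ultimately show ?thesis by (simp only: simp_thms)
qed

end
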